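(* Let $N \ge 2$, let $\mathbf{X}=(\mathbf{X}(t))_{t\in\mathbb{N}_0}$ be the coagulation-fragmentation Markov chain on the simplex $\Delta_{N-1}$ with an arbitrary initial distribution $\mu_0$ on $\Delta_{N-1}$, and let $\mu_t$ denote the distribution of $\mathbf{X}(t)$ for $t\in\mathbb{N}_0$. Then the uniform distribution on $\Delta_{N-1}$ is the unique invariant distribution of the chain, and it is the weak limit of the sequence $\mu_t$ as $t\to\infty$.
   Context: The simplex is $\Delta_{N-1}=\{\mathbf{x}=(x_1,\ldots,x_N): x_i\ge 0 \text{ for all } i,\ \sum_{i=1}^N x_i=1\}$. The uniform distribution on $\Delta_{N-1}$ is the normalized $(N-1)$-dimensional Lebesgue measure on $\Delta_{N-1}$. The coagulation-fragmentation Markov chain on $\Delta_{N-1}$ is the time-homogeneous discrete-time chain with the following one-step dynamics. Given $\mathbf{X}(t)=\mathbf{x}=(x_1,\ldots,x_N)$, choose an ordered pair $(i,j)$ of distinct indices in $\{1,\ldots,N\}$ uniformly at random (each with probability $\frac{1}{N(N-1)}$) and, independently, $u$ uniformly distributed on $[0,1]$, both independent of the past. Then $\mathbf{X}(t+1)$ is the vector whose $i$-th coordinate is $u(x_i+x_j)$, whose $j$-th coordinate is $(1-u)(x_i+x_j)$, and whose other coordinates equal those of $\mathbf{x}$. *)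

theory Defs
  imports "HOL-Probability.Probability"
begin

definition prob_simplex :: "(real ^ 'n) set" where
  "prob_simplex = {x. (\<forall>i. 0 \<le> x $ i) \<and> (\<Sum>i\<in>UNIV. x $ i) = 1}"

abbreviation simplex_space :: "(real ^ 'n) measure" where
  "simplex_space \<equiv> restrict_space borel prob_simplex"

text \<open>Lebesgue measure on the hyperplane of vectors with coordinate sum 1, which is identified with
  a Euclidean space of one dimension less by dropping the coordinate \<open>k\<close>. By convention the volume
  is that of the parameter domain; it differs from the Euclidean surface volume by a constant factor,
  which cancels on normalization. The measure does not depend on \<open>k\<close>
  (\<open>hyperplane_lebesgue_indep\<close> below).\<close>

definition hyperplane_point :: "'n \<Rightarrow> ('n \<Rightarrow> real) \<Rightarrow> real ^ 'n" where
  "hyperplane_point k y = (\<chi> i. if i = k then 1 - (\<Sum>j\<in>UNIV - {k}. y j) else y i)"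

definition hyperplane_lebesgue :: "'n \<Rightarrow> (real ^ 'n) measure" where
  "hyperplane_lebesgue k = distr (PiM (UNIV - {k}) (\<lambda>_. lborel)) borel (hyperplane_point k)"

definition simplex_uniform :: "(real ^ 'n) measure" where
  "simplex_uniform =
     uniform_measure (restrict_space (hyperplane_lebesgue (SOME k. True)) prob_simplex) prob_simplex"

definition coag_frag_step :: "'n \<Rightarrow> 'n \<Rightarrow> real \<Rightarrow> real ^ 'n \<Rightarrow> real ^ 'n" where
  "coag_frag_step i j u x =
     (\<chi> l. if l = i then u * (x $ i + x $ j)
           else if l = j then (1 - u) * (x $ i + x $ j)
           else x $ l)"

text \<open>The transition kernel. Lebesgue measure restricted to the unit interval has total mass 1,
  so no normalization is needed for the variable \<open>u\<close>.\<close>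

definition coag_frag_kernel :: "real ^ 'n \<Rightarrow> (real ^ 'n) measure" where
  "coag_frag_kernel x =
     distr (uniform_count_measure {(i, j). i \<noteq> j} \<Otimes>\<^sub>M restrict_space lborel {0..1})
       simplex_space (\<lambda>((i, j), u). coag_frag_step i j u x)"

definition coag_frag_invariant :: "(real ^ 'n) measure \<Rightarrow> bool" where
  "coag_frag_invariant \<nu> \<longleftrightarrow>
     \<nu> \<in> space (prob_algebra simplex_space) \<and> \<nu> \<bind> coag_frag_kernel = \<nu>"

definition past :: "'w measure \<Rightarrow> 'a measure \<Rightarrow> (nat \<Rightarrow> 'w \<Rightarrow> 'a) \<Rightarrow> nat \<Rightarrow> 'w measure" where
  "past M S X t = vimage_algebra (space M) (\<lambda>\<omega>. \<lambda>s\<in>{..t}. X s \<omega>) (PiM {..t} (\<lambda>_. S))"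

definition coag_frag_chain ::
    "'w measure \<Rightarrow> (nat \<Rightarrow> 'w \<Rightarrow> real ^ 'n) \<Rightarrow> (real ^ 'n) measure \<Rightarrow> bool" where
  "coag_frag_chain M X \<mu>\<^sub>0 \<longleftrightarrow>
     prob_space M \<and>
     (\<forall>t. X t \<in> M \<rightarrow>\<^sub>M simplex_space) \<and>
     distr M simplex_space (X 0) = \<mu>\<^sub>0 \<and>
     (\<forall>t. \<forall>A\<in>sets simplex_space. AE \<omega> in M.
        real_cond_exp M (past M simplex_space X t) (\<lambda>\<omega>. indicator A (X (Suc t) \<omega>)) \<omega>
          = measure (coag_frag_kernel (X t \<omega>)) A)"

text \<open>Weak convergence of finite Borel measures on a set \<open>S\<close>; the library's \<open>weak_conv_m\<close> only
  covers measures on the real line.\<close>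

definition weakly_converges_on ::
    "'a::topological_space set \<Rightarrow> (nat \<Rightarrow> 'a measure) \<Rightarrow> 'a measure \<Rightarrow> bool" where
  "weakly_converges_on S \<mu> \<nu> \<longleftrightarrow>
     (\<forall>f :: 'a \<Rightarrow> real. continuous_on S f \<longrightarrow> bounded (f ` S) \<longrightarrow>
        (\<lambda>t. integral\<^sup>L (\<mu> t) f) \<longlonglongrightarrow> integral\<^sup>L \<nu> f)"

text \<open>Basic facts: the kernel is measurable, the uniform distribution is a probability measure on the
  simplex, and the conditional expectations in \<open>coag_frag_chain\<close> are taken with respect to a
  sub-\<open>\<sigma>\<close>-algebra.\<close>

lemma borel_measurable_vec_lambda [measurable]:
  fixes f :: "'i::finite \<Rightarrow> 'a \<Rightarrow> real"
  assumes "\<And>i. f i \<in> borel_measurable M"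
  shows "(\<lambda>x. \<chi> i. f i x) \<in> borel_measurable M"
  using assms
  by (subst borel_measurable_euclidean_space) (auto simp: Basis_vec_def inner_axis)

lemma borel_measurable_vec_nth [measurable]: "(\<lambda>x :: real ^ 'n. x $ i) \<in> borel_measurable borel"
  by (intro borel_measurable_continuous_onI continuous_intros)

lemma closed_prob_simplex: "closed (prob_simplex :: (real ^ 'n) set)"
proof -
  have "prob_simplex = (\<Inter>i. {x :: real ^ 'n. 0 \<le> x $ i}) \<inter> {x. (\<Sum>i\<in>UNIV. x $ i) = 1}"
    by (auto simp: prob_simplex_def)
  moreover have "closed \<dots>"
    by (intro closed_Int closed_INT ballI closed_Collect_le closed_Collect_eq continuous_intros)
  ultimately show ?thesis by simp
qed

lemma prob_simplex_nonempty: "(prob_simplex :: (real ^ 'n) set) \<noteq> {}"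
proof -
  have "axis k 1 \<in> (prob_simplex :: (real ^ 'n) set)" for k
    by (auto simp: prob_simplex_def axis_def)
  then show ?thesis by blast
qed

lemma coag_frag_step_mem:
  assumes "i \<noteq> j" "u \<in> {0..1}" "x \<in> prob_simplex"
  shows "coag_frag_step i j u x \<in> prob_simplex"
proof -
  have U: "UNIV = insert i (insert j (UNIV - {i, j}))" by auto
  have "(\<Sum>l\<in>UNIV. coag_frag_step i j u x $ l) = (\<Sum>l\<in>UNIV. x $ l)"
    using assms(1)
    by (subst (1 2) U) (auto simp: coag_frag_step_def algebra_simps intro!: sum.cong)
  then show ?thesis
    using assms by (auto simp: prob_simplex_def coag_frag_step_def)
qed

lemma coag_frag_kernel_measurable:
  assumes "CARD('n::finite) \<ge> 2"
  shows "(coag_frag_kernel :: real ^ 'n \<Rightarrow> _) \<in> simplex_space \<rightarrow>\<^sub>M prob_algebra simplex_space"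
proof -
  let ?A = "{(i :: 'n, j). i \<noteq> j}"
  let ?C = "uniform_count_measure ?A"
  let ?U = "restrict_space lborel {0..1 :: real}"
  let ?f = "\<lambda>x :: real ^ 'n. \<lambda>((i, j), u). coag_frag_step i j u x"
  let ?Z = "simplex_space \<Otimes>\<^sub>M (?C \<Otimes>\<^sub>M ?U)"
  have "\<exists>i j :: 'n. i \<noteq> j"
    using ex_card[OF assms] by (metis card_2_iff)
  then have ne: "?A \<noteq> {}" by auto
  interpret C: prob_space ?C by (rule prob_space_uniform_count_measure) (use ne in auto)
  have "emeasure ?U (space ?U) = 1"
    by (subst emeasure_restrict_space) (auto simp: space_restrict_space)
  then interpret U: prob_space ?U by (rule prob_spaceI)
  interpret P: pair_prob_space ?C ?U ..
  have comp: "(\<lambda>z. fst (snd z)) \<in> ?Z \<rightarrow>\<^sub>M count_space ?A"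
    using measurable_compose[OF measurable_snd measurable_fst, of simplex_space ?C ?U]
    by (simp add: measurable_cong_sets[OF refl sets_uniform_count_measure_count_space])
  have x: "(\<lambda>z. fst z) \<in> ?Z \<rightarrow>\<^sub>M borel"
    by (rule measurable_compose[OF measurable_fst
        measurable_restrict_space1[OF measurable_ident_sets[OF refl]]])
  have u: "(\<lambda>z. snd (snd z)) \<in> ?Z \<rightarrow>\<^sub>M borel"
    by (rule measurable_compose[OF measurable_compose[OF measurable_snd measurable_snd]
        measurable_restrict_space1[OF measurable_ident_sets[OF sets_lborel]]])
  have xl [measurable]: "(\<lambda>z. fst z $ l) \<in> borel_measurable ?Z" for l
    using x by (rule measurable_compose) (rule borel_measurable_vec_nth)
  note u [measurable]
  have "(\<lambda>z. coag_frag_step (fst (fst (snd z))) (snd (fst (snd z))) (snd (snd z)) (fst z))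
      \<in> ?Z \<rightarrow>\<^sub>M borel"
  proof (rule measurable_compose_countable'[OF _ comp,
        where f="\<lambda>a z. coag_frag_step (fst a) (snd a) (snd (snd z)) (fst z)"])
    fix a :: "'n \<times> 'n"
    show "(\<lambda>z. coag_frag_step (fst a) (snd a) (snd (snd z)) (fst z)) \<in> ?Z \<rightarrow>\<^sub>M borel"
      unfolding coag_frag_step_def
    proof (rule borel_measurable_vec_lambda)
      fix l
      show "(\<lambda>z. if l = fst a then snd (snd z) * (fst z $ fst a + fst z $ snd a)
          else if l = snd a then (1 - snd (snd z)) * (fst z $ fst a + fst z $ snd a)
          else fst z $ l) \<in> borel_measurable ?Z"
        by (cases "l = fst a"; cases "l = snd a") simp_all
    qed
  qed (auto intro: countable_finite)
  then have "case_prod ?f \<in> ?Z \<rightarrow>\<^sub>M simplex_space"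
    by (intro measurable_restrict_space2)
      (auto simp: space_pair_measure space_uniform_count_measure space_restrict_space
        case_prod_beta' intro!: coag_frag_step_mem)
  then have meas: "(\<lambda>x. distr (?C \<Otimes>\<^sub>M ?U) simplex_space (?f x))
      \<in> simplex_space \<rightarrow>\<^sub>M subprob_algebra simplex_space"
    by (rule measurable_distr2) (simp add: space_subprob_algebra P.subprob_space_axioms)
  have "prob_space (coag_frag_kernel x)" if "x \<in> space simplex_space" for x :: "real ^ 'n"
    unfolding coag_frag_kernel_def
    using measurable_Pair2[OF \<open>case_prod ?f \<in> ?Z \<rightarrow>\<^sub>M simplex_space\<close> that]
    by (intro P.prob_space_distr) simp
  then show ?thesis
    using meas unfolding coag_frag_kernel_def[symmetric]
    by (intro measurable_prob_algebraI)
qed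

lemma hyperplane_point_measurable [measurable]:
  "hyperplane_point k \<in> borel_measurable (PiM (UNIV - {k}) (\<lambda>_. lborel))"
  unfolding hyperplane_point_def
proof (rule borel_measurable_vec_lambda)
  fix i
  show "(\<lambda>y. if i = k then 1 - (\<Sum>j\<in>UNIV - {k}. y j) else y i)
      \<in> borel_measurable (PiM (UNIV - {k}) (\<lambda>_. lborel))"
    by (cases "i = k") (auto intro!: borel_measurable_diff borel_measurable_sum
      measurable_component_singleton[where M="\<lambda>_. lborel", simplified])
qed

lemma hyperplane_lebesgue_indep: "hyperplane_lebesgue k = hyperplane_lebesgue l"
proof (cases "k = l")
  case False
  interpret product_sigma_finite "\<lambda>_ :: 'a. lborel :: real measure" ..
  let ?J = "UNIV - {k, l}"
  have K: "UNIV - {k} = insert l ?J" and L: "UNIV - {l} = insert k ?J"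
    using False by auto
  have pt: "hyperplane_point k (y(l := t)) = hyperplane_point l (y(k := (1 - (\<Sum>j\<in>?J. y j)) + (- 1) * t))"
    for y t
    unfolding hyperplane_point_def K L using False
    by (auto simp: vec_eq_iff sum.insert_if intro!: sum.cong)
  show ?thesis
  proof (rule measure_eqI)
    fix A :: "(real ^ 'a) set"
    assume "A \<in> sets (hyperplane_lebesgue k)"
    then have A [measurable]: "A \<in> sets borel" by (simp add: hyperplane_lebesgue_def)
    have em: "emeasure (hyperplane_lebesgue m) A
        = (\<integral>\<^sup>+ y. indicator A (hyperplane_point m y) \<partial>PiM (UNIV - {m}) (\<lambda>_. lborel))" for m
      unfolding hyperplane_lebesgue_def
      by (subst nn_integral_indicator[symmetric], simp, subst nn_integral_distr) auto
    have meas: "(\<lambda>y. indicator A (hyperplane_point m y) :: ennreal)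
        \<in> borel_measurable (PiM (UNIV - {m}) (\<lambda>_. lborel))" for m
      by measurable
    have "emeasure (hyperplane_lebesgue k) A
        = (\<integral>\<^sup>+ y. (\<integral>\<^sup>+ t. indicator A (hyperplane_point k (y(l := t))) \<partial>lborel) \<partial>PiM ?J (\<lambda>_. lborel))"
      unfolding em using meas[of k] unfolding K by (subst product_nn_integral_insert) auto
    also have "\<dots>
        = (\<integral>\<^sup>+ y. (\<integral>\<^sup>+ t. indicator A (hyperplane_point l (y(k := t))) \<partial>lborel) \<partial>PiM ?J (\<lambda>_. lborel))"
    proof (rule nn_integral_cong)
      fix y assume y: "y \<in> space (PiM ?J (\<lambda>_. lborel :: real measure))"
      have "(\<lambda>t. y(k := t)) \<in> lborel \<rightarrow>\<^sub>M PiM (insert k ?J) (\<lambda>_. lborel)"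
        using y by (intro measurable_fun_upd[where J="?J"]) auto
      from measurable_compose[OF this, of "\<lambda>y. indicator A (hyperplane_point l y) :: ennreal" borel]
      have "(\<lambda>t. indicator A (hyperplane_point l (y(k := t))) :: ennreal) \<in> borel_measurable borel"
        using meas[of l] unfolding L by simp
      from nn_integral_real_affine[OF this, of "- 1" "1 - (\<Sum>j\<in>?J. y j)"]
      show "(\<integral>\<^sup>+ t. indicator A (hyperplane_point k (y(l := t))) \<partial>lborel)
          = (\<integral>\<^sup>+ t. indicator A (hyperplane_point l (y(k := t))) \<partial>lborel)"
        by (simp add: pt)
    qed
    also have "\<dots> = emeasure (hyperplane_lebesgue l) A"
      unfolding em using meas[of l] unfolding L by (subst product_nn_integral_insert) auto
    finally show "emeasure (hyperplane_lebesgue k) A = emeasure (hyperplane_lebesgue l) A" .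
  qed (simp add: hyperplane_lebesgue_def)
qed simp

lemma prob_simplex_sets [measurable]: "prob_simplex \<in> sets borel"
  using closed_prob_simplex by (rule borel_closed)

lemma emeasure_hyperplane_lebesgue_prob_simplex:
  "0 < emeasure (hyperplane_lebesgue k) prob_simplex"
  "emeasure (hyperplane_lebesgue k) prob_simplex < \<infinity>"
proof -
  interpret product_sigma_finite "\<lambda>_ :: 'a. lborel :: real measure" ..
  let ?P = "PiM (UNIV - {k}) (\<lambda>_. lborel) :: ('a \<Rightarrow> real) measure"
  let ?V = "hyperplane_point k -` prob_simplex \<inter> space ?P"
  let ?c = "1 / real CARD('a)"
  have em: "emeasure (hyperplane_lebesgue k) prob_simplex = emeasure ?P ?V"
    unfolding hyperplane_lebesgue_def by (subst emeasure_distr) auto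
  have Vs: "?V \<in> sets ?P" by measurable
  have box: "emeasure ?P (PiE (UNIV - {k}) (\<lambda>_. {0..c})) = ennreal c ^ (CARD('a) - 1)"
    if "c \<ge> 0" for c
    using that emeasure_PiM[of "UNIV - {k}" "\<lambda>_. {0..c}"] by simp
  have "PiE (UNIV - {k}) (\<lambda>_. {0..?c}) \<subseteq> ?V"
  proof
    fix y assume y: "y \<in> PiE (UNIV - {k}) (\<lambda>_. {0..?c})"
    then have y1: "y \<in> extensional (UNIV - {k})" and y2: "\<And>i. i \<noteq> k \<Longrightarrow> 0 \<le> y i \<and> y i \<le> ?c"
      by (auto simp: PiE_iff)
    have "(\<Sum>j\<in>UNIV - {k}. y j) \<le> real (card (UNIV - {k})) * ?c"
      by (rule sum_bounded_above) (use y2 in simp)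
    also have "\<dots> \<le> 1" by simp
    finally have s: "(\<Sum>j\<in>UNIV - {k}. y j) \<le> 1" .
    have "(\<Sum>i\<in>UNIV. hyperplane_point k y $ i) = 1"
      by (subst sum.remove[of _ k]) (auto simp: hyperplane_point_def)
    moreover have "0 \<le> hyperplane_point k y $ i" for i
      using y2[of i] s by (simp add: hyperplane_point_def)
    moreover have "y \<in> space ?P"
      using y1 by (simp add: space_PiM PiE_iff)
    ultimately show "y \<in> ?V"
      by (simp add: prob_simplex_def)
  qed
  then have "ennreal ?c ^ (CARD('a) - 1) \<le> emeasure ?P ?V"
    using box[of ?c] by (metis Vs emeasure_mono divide_nonneg_nonneg of_nat_0_le_iff zero_le_one)
  moreover have "0 < ennreal ?c ^ (CARD('a) - 1)"
    by (simp add: ennreal_power)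
  ultimately show "0 < emeasure (hyperplane_lebesgue k) prob_simplex"
    unfolding em by (rule less_le_trans[rotated])
  have "?V \<subseteq> PiE (UNIV - {k}) (\<lambda>_. {0..1})"
  proof
    fix y assume y: "y \<in> ?V"
    have le: "x $ i \<le> 1" if "x \<in> prob_simplex" for x :: "real ^ 'a" and i
      using that member_le_sum[of i UNIV "\<lambda>i. x $ i"] by (auto simp: prob_simplex_def)
    have "0 \<le> hyperplane_point k y $ i \<and> hyperplane_point k y $ i \<le> 1" for i
      using y le by (auto simp: prob_simplex_def)
    moreover have "hyperplane_point k y $ i = y i" if "i \<noteq> k" for i
      using that by (simp add: hyperplane_point_def)
    ultimately have "\<forall>i\<in>UNIV - {k}. y i \<in> {0..1}"
      by (metis DiffE atLeastAtMost_iff insertI1)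
    then show "y \<in> PiE (UNIV - {k}) (\<lambda>_. {0..1})"
      using y by (simp add: space_PiM PiE_iff)
  qed
  then have "emeasure ?P ?V \<le> emeasure ?P (PiE (UNIV - {k}) (\<lambda>_. {0..1}))"
    by (rule emeasure_mono) (auto intro!: sets_PiM_I_finite)
  also have "\<dots> < \<infinity>" using box[of 1] by simp
  finally show "emeasure (hyperplane_lebesgue k) prob_simplex < \<infinity>" unfolding em .
qed

lemma simplex_uniform_prob:
  "(simplex_uniform :: (real ^ 'n) measure) \<in> space (prob_algebra simplex_space)"
proof -
  let ?H = "hyperplane_lebesgue (SOME k :: 'n. True)"
  have "emeasure (restrict_space ?H prob_simplex) prob_simplex = emeasure ?H prob_simplex"
    by (subst emeasure_restrict_space) (auto simp: hyperplane_lebesgue_def)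
  then have "prob_space (simplex_uniform :: (real ^ 'n) measure)"
    unfolding simplex_uniform_def
    using emeasure_hyperplane_lebesgue_prob_simplex[of "SOME k :: 'n. True"]
    by (intro prob_space_uniform_measure) auto
  moreover have "sets ?H = sets borel"
    by (simp add: hyperplane_lebesgue_def)
  then have "sets (simplex_uniform :: (real ^ 'n) measure) = sets simplex_space"
    by (simp add: simplex_uniform_def sets_restrict_space)
  ultimately show ?thesis
    by (simp add: space_prob_algebra)
qed

lemma subalgebra_past:
  assumes "\<And>s. X s \<in> M \<rightarrow>\<^sub>M S"
  shows "subalgebra M (past M S X t)"
proof -
  have "(\<lambda>\<omega>. \<lambda>s\<in>{..t}. X s \<omega>) \<in> M \<rightarrow>\<^sub>M PiM {..t} (\<lambda>_. S)"
    by (rule measurable_restrict) (use assms in auto)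
  then show ?thesis
    unfolding subalgebra_def past_def
    by (auto simp: sets_vimage_algebra2 measurable_def)
qed

end

theory Submission
  imports Defs
begin

text \<open>
  Two facts carry the theorem.

  The uniform distribution is invariant, and this holds for every pair \<open>(i, j)\<close> separately. Conditionally on
  the coordinates other than \<open>i\<close> and \<open>j\<close>, a uniform point of the simplex has \<open>x\<^sub>i\<close> uniform on
  \<open>[0, x\<^sub>i + x\<^sub>j]\<close>, and the step draws \<open>x\<^sub>i\<close> afresh from exactly this distribution. The formal version is Fubini
  along the lines in direction \<open>(i, j)\<close> (\<open>nn_integral_step_hyperplane_lebesgue\<close>).

  The chain contracts in mean square. Run two copies with the same pairs and the same fractions \<open>u\<close>. Their
  difference \<open>v\<close> has coordinate sum zero and is moved by the same linear step, and the mean of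
  \<open>\<bar>v\<bar>\<^sup>2\<close> is multiplied in each step by \<open>c = 1 - 2 (N + 1) / (3 N (N - 1))\<close>, where \<open>0 \<le> c < 1\<close>
  (\<open>integral_norm_step_sq\<close>). Instead of building the coupled chain, the proof transports this estimate to test
  functions: if \<open>\<bar>f x - f y\<bar> \<le> \<epsilon> + K \<bar>x - y\<bar>\<^sup>2\<close> on the simplex, then the kernel maps \<open>f\<close> to a function
  with the same property for \<open>\<epsilon>\<close> and \<open>c K\<close> (\<open>quad_lipschitz_kernel\<close>). By compactness every continuous \<open>f\<close> has
  this property for every \<open>\<epsilon> > 0\<close> and some \<open>K\<close>. Hence after \<open>t\<close> steps the integrals of \<open>f\<close> under any two
  initial distributions differ by at most \<open>\<epsilon> + 4 c\<^sup>t K\<close> (\<open>evolution_merging\<close>).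

  If one of the two initial distributions is the uniform one, it stays put, and the estimate says that every
  evolution converges to it weakly. An invariant distribution is itself such an evolution, constant in time, so its
  integrals of continuous functions agree with those of the uniform distribution, and the two are equal
  (\<open>simplex_measure_eqI\<close>).
\<close>

section \<open>The noise driving one step\<close>

abbreviation index_pairs :: "('n \<times> 'n) set" where
  "index_pairs \<equiv> {(i, j). i \<noteq> j}"

text \<open>The randomness of one step does not depend on the current state, so the same pair and the same
  fraction can drive two copies of the chain. This is the coupling behind the convergence proof.\<close>

abbreviation step_noise :: "(('n \<times> 'n) \<times> real) measure" where
  "step_noise \<equiv> uniform_count_measure index_pairs \<Otimes>\<^sub>M restrict_space lborel {0..1}"

lemma index_pairs_nonempty:
  assumes "CARD('n::finite) \<ge> 2"
  shows "(index_pairs :: ('n \<times> 'n) set) \<noteq> {}"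
proof -
  have "\<exists>i j :: 'n. i \<noteq> j"
    using ex_card[OF assms] by (metis card_2_iff)
  then show ?thesis by auto
qed

lemma sum_index_pairs:
  fixes g :: "'n::finite \<Rightarrow> 'n \<Rightarrow> 'a::ab_group_add"
  shows "(\<Sum>(i, j)\<in>index_pairs. g i j) = (\<Sum>i\<in>UNIV. \<Sum>j\<in>UNIV. g i j) - (\<Sum>i\<in>UNIV. g i i)"
proof -
  have "index_pairs = (SIGMA i : (UNIV :: 'n set). UNIV - {i})"
    by auto
  then have "(\<Sum>(i, j)\<in>index_pairs. g i j) = (\<Sum>i\<in>UNIV. \<Sum>j\<in>UNIV - {i}. g i j)"
    by (simp add: sum.Sigma)
  also have "\<dots> = (\<Sum>i\<in>UNIV. (\<Sum>j\<in>UNIV. g i j) - g i i)"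
    by (simp add: sum_diff1)
  finally show ?thesis
    by (simp add: sum_subtractf)
qed

lemma card_index_pairs:
  "real (card (index_pairs :: ('n::finite \<times> 'n) set)) = real CARD('n) * (real CARD('n) - 1)"
  using sum_index_pairs[of "\<lambda>(_ :: 'n) _. 1 :: real"]
  by (simp add: case_prod_unfold algebra_simps)

lemma prob_space_unit_interval: "prob_space (restrict_space lborel {0..1 :: real})"
proof
  show "emeasure (restrict_space lborel {0..1 :: real}) (space (restrict_space lborel {0..1})) = 1"
    by (subst emeasure_restrict_space) (auto simp: space_restrict_space)
qed

lemma prob_space_index_pairs:
  assumes "CARD('n::finite) \<ge> 2"
  shows "prob_space (uniform_count_measure (index_pairs :: ('n \<times> 'n) set))"
  using index_pairs_nonempty[OF assms] by (intro prob_space_uniform_count_measure) auto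

lemma pair_prob_space_noise:
  assumes "CARD('n::finite) \<ge> 2"
  shows "pair_prob_space (uniform_count_measure (index_pairs :: ('n \<times> 'n) set))
    (restrict_space lborel {0..1 :: real})"
  using prob_space_index_pairs[OF assms] prob_space_unit_interval
  by (simp add: pair_prob_space_def pair_sigma_finite_def prob_space_imp_sigma_finite)

lemma measurable_step_pair [measurable]:
  "(\<lambda>(x, u). coag_frag_step i j u x) \<in> borel \<Otimes>\<^sub>M borel \<rightarrow>\<^sub>M borel"
  unfolding coag_frag_step_def case_prod_unfold
proof (rule borel_measurable_vec_lambda)
  fix l
  show "(\<lambda>z :: (real ^ 'a) \<times> real. if l = i then snd z * (fst z $ i + fst z $ j)
      else if l = j then (1 - snd z) * (fst z $ i + fst z $ j)
      else fst z $ l) \<in> borel_measurable (borel \<Otimes>\<^sub>M borel)"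
    by (cases "l = i"; cases "l = j") simp_all
qed

lemma measurable_step_fraction [measurable]:
  "(\<lambda>u. coag_frag_step i j u x) \<in> borel \<rightarrow>\<^sub>M borel"
  using measurable_compose[OF measurable_Pair1'[of x borel] measurable_step_pair] by simp

lemma measurable_step_noise_borel:
  "(\<lambda>((i, j), u). coag_frag_step i j u x) \<in> step_noise \<rightarrow>\<^sub>M borel"
proof -
  have "(\<lambda>((i, j), u). coag_frag_step i j u x)
      \<in> count_space index_pairs \<Otimes>\<^sub>M restrict_space lborel {0..1} \<rightarrow>\<^sub>M borel"
    by (rule measurable_pair_measure_countable1)
      (auto intro!: measurable_restrict_space1 countable_finite)
  then show ?thesis
    by (simp cong: measurable_cong_sets add: sets_pair_measure_cong[OF sets_uniform_count_measure_count_space refl])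
qed

lemma measurable_step_noise:
  assumes "x \<in> prob_simplex"
  shows "(\<lambda>((i, j), u). coag_frag_step i j u x) \<in> step_noise \<rightarrow>\<^sub>M simplex_space"
  using measurable_step_noise_borel assms
  by (intro measurable_restrict_space2)
    (auto simp: space_pair_measure space_uniform_count_measure space_restrict_space
      intro!: coag_frag_step_mem)

section \<open>Contraction of the synchronous coupling\<close>

lemma norm_sq_eq_sum:
  fixes w :: "real ^ 'n"
  shows "(norm w)\<^sup>2 = (\<Sum>l\<in>UNIV. (w $ l)\<^sup>2)"
  by (simp add: norm_vec_def L2_set_def sum_nonneg)

lemma norm_step_sq:
  fixes v :: "real ^ 'n"
  assumes "i \<noteq> j"
  shows "(norm (coag_frag_step i j u v))\<^sup>2
    = (norm v)\<^sup>2 - (v $ i)\<^sup>2 - (v $ j)\<^sup>2 + (u\<^sup>2 + (1 - u)\<^sup>2) * (v $ i + v $ j)\<^sup>2"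
proof -
  have U: "UNIV = insert i (insert j (UNIV - {i, j}))" by auto
  have "(\<Sum>l\<in>UNIV - {i, j}. (coag_frag_step i j u v $ l)\<^sup>2) = (\<Sum>l\<in>UNIV - {i, j}. (v $ l)\<^sup>2)"
    by (rule sum.cong) (auto simp: coag_frag_step_def)
  moreover have "(coag_frag_step i j u v $ i)\<^sup>2 + (coag_frag_step i j u v $ j)\<^sup>2
      = (u\<^sup>2 + (1 - u)\<^sup>2) * (v $ i + v $ j)\<^sup>2"
    using assms by (simp add: coag_frag_step_def power_mult_distrib distrib_right)
  ultimately show ?thesis
    using assms unfolding norm_sq_eq_sum by (subst (1 2) U) simp
qed

lemma integral_unit_interval_quadratic:
  fixes a b :: real
  shows "(\<integral>u. a + (u\<^sup>2 + (1 - u)\<^sup>2) * b \<partial>restrict_space lborel {0..1}) = a + 2 / 3 * b"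
proof -
  \<comment> \<open>The right-hand side is kept in the unevaluated form \<open>F 1 - F 0\<close> so that the rule applies.\<close>
  have "(\<integral>u. indicator {0..1} u *\<^sub>R (a + (u\<^sup>2 + (1 - u)\<^sup>2) * b) \<partial>lborel)
      = (a * 1 + (1 ^ 3 / 3 - (1 - 1) ^ 3 / 3) * b) - (a * 0 + (0 ^ 3 / 3 - (1 - 0) ^ 3 / 3) * b)"
    by (rule integral_FTC_atLeastAtMost[where F="\<lambda>u. a * u + (u ^ 3 / 3 - (1 - u) ^ 3 / 3) * b"])
      (auto intro!: derivative_eq_intros continuous_intros
        simp: has_real_derivative_iff_has_vector_derivative[symmetric] power2_eq_square field_simps)
  then show ?thesis
    by (subst integral_restrict_space) simp_all
qed

text \<open>The mean factor by which one step shrinks the squared distance of two synchronously driven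
  states.\<close>

definition contraction_rate :: "nat \<Rightarrow> real" where
  "contraction_rate N = 1 - 2 * (real N + 1) / (3 * real N * (real N - 1))"

lemma contraction_rate_bounds:
  assumes "N \<ge> 2"
  shows "0 \<le> contraction_rate N" "contraction_rate N < 1"
proof -
  have N: "real N \<ge> 2" using assms by simp
  then have "0 \<le> (real N - 2) * (3 * real N + 1)" by simp
  then have "2 * (real N + 1) \<le> 3 * real N * (real N - 1)" by (simp add: algebra_simps)
  then show "0 \<le> contraction_rate N"
    using N by (simp add: contraction_rate_def divide_le_eq_1)
  show "contraction_rate N < 1"
    using N by (simp add: contraction_rate_def)
qed

text \<open>The step is linear in the state, so the difference \<open>v\<close> of two states driven by the same noise is
  itself moved by the step, and its coordinates sum to zero. Averaging over \<open>u\<close> turns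
  \<open>u\<^sup>2 + (1 - u)\<^sup>2\<close> into \<open>2 / 3\<close>. Summed over all pairs, the mixed terms
  \<open>v\<^sub>i v\<^sub>j\<close> collect into the square of the coordinate sum and disappear, which leaves a negative
  multiple of the squared norm. A single draw of the noise can move two states further apart; the
  contraction holds in the mean.\<close>

lemma
  fixes v :: "real ^ 'n"
  assumes "CARD('n) \<ge> 2" "(\<Sum>l\<in>UNIV. v $ l) = 0"
  shows integrable_norm_step_sq:
      "integrable step_noise (\<lambda>((i, j), u). (norm (coag_frag_step i j u v))\<^sup>2)" (is ?I)
    and integral_norm_step_sq:
      "(\<integral>((i, j), u). (norm (coag_frag_step i j u v))\<^sup>2 \<partial>step_noise)
        = contraction_rate CARD('n) * (norm v)\<^sup>2" (is ?E)
proof -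
  let ?N = "real CARD('n)"
  let ?g = "\<lambda>((i, j), u). (norm (coag_frag_step i j u v))\<^sup>2"
  interpret P: pair_prob_space "uniform_count_measure (index_pairs :: ('n \<times> 'n) set)"
      "restrict_space lborel {0..1 :: real}"
    by (rule pair_prob_space_noise[OF assms(1)])
  have meas: "?g \<in> borel_measurable step_noise"
    using measurable_compose[OF measurable_step_noise_borel, of "\<lambda>w. (norm w)\<^sup>2" borel v]
    by (simp add: case_prod_unfold)
  have bound: "(norm (coag_frag_step i j u v))\<^sup>2 \<le> 9 * (norm v)\<^sup>2" if "i \<noteq> j" "u \<in> {0..1}" for i j u
  proof -
    have "\<bar>v $ i + v $ j\<bar> \<le> 2 * norm v"
      using component_le_norm_cart[of v i] component_le_norm_cart[of v j] by linarith
    then have "(v $ i + v $ j)\<^sup>2 \<le> (2 * norm v)\<^sup>2"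
      by (metis abs_ge_zero power2_abs power_mono)
    moreover have "u\<^sup>2 + (1 - u)\<^sup>2 \<le> 1 + 1"
      using that by (intro add_mono) (auto intro!: power_le_one)
    ultimately have "(u\<^sup>2 + (1 - u)\<^sup>2) * (v $ i + v $ j)\<^sup>2 \<le> (1 + 1) * (2 * norm v)\<^sup>2"
      by (intro mult_mono) auto
    then have "(u\<^sup>2 + (1 - u)\<^sup>2) * (v $ i + v $ j)\<^sup>2 \<le> 8 * (norm v)\<^sup>2"
      by (simp add: power_mult_distrib)
    then show ?thesis
      unfolding norm_step_sq[OF that(1)]
      using zero_le_power2[of "v $ i"] zero_le_power2[of "v $ j"] zero_le_power2[of "norm v"]
      by linarith
  qed
  show int: ?I
    by (rule P.P.integrable_const_bound[OF _ meas, where B="9 * (norm v)\<^sup>2"])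
      (auto intro!: AE_I2 bound simp: space_pair_measure space_uniform_count_measure
        space_restrict_space)
  have "integral\<^sup>L step_noise ?g
      = (\<integral>p. (\<integral>u. ?g (p, u) \<partial>restrict_space lborel {0..1})
          \<partial>uniform_count_measure index_pairs)"
    using P.integral_fst'[OF int] by simp
  also have "\<dots> = (\<Sum>p\<in>index_pairs. \<integral>u. ?g (p, u) \<partial>restrict_space lborel {0..1})
      / card (index_pairs :: ('n \<times> 'n) set)"
    by (rule integral_uniform_count_measure) simp
  also have "(\<Sum>p\<in>index_pairs. \<integral>u. ?g (p, u) \<partial>restrict_space lborel {0..1})
      = (\<Sum>(i, j)\<in>index_pairs. (norm v)\<^sup>2 - (v $ i)\<^sup>2 - (v $ j)\<^sup>2 + 2 / 3 * (v $ i + v $ j)\<^sup>2)"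
    by (rule sum.cong)
      (auto simp: norm_step_sq integral_unit_interval_quadratic)
  also have "\<dots> = (?N * (?N - 1) - 2 / 3 * (?N + 1)) * (norm v)\<^sup>2"
  proof -
    have "(\<Sum>i\<in>UNIV. \<Sum>j\<in>UNIV. (norm v)\<^sup>2 - (v $ i)\<^sup>2 - (v $ j)\<^sup>2 + 2 / 3 * (v $ i + v $ j)\<^sup>2)
        = (\<Sum>i\<in>UNIV. \<Sum>j\<in>UNIV. (norm v)\<^sup>2 - 1 / 3 * (v $ i)\<^sup>2 - 1 / 3 * (v $ j)\<^sup>2 + 4 / 3 * (v $ i * v $ j))"
      by (intro sum.cong refl) (simp add: power2_eq_square field_simps)
    also have "\<dots> = (\<Sum>i\<in>UNIV. \<Sum>j\<in>UNIV. (norm v)\<^sup>2 - 1 / 3 * (v $ i)\<^sup>2 - 1 / 3 * (v $ j)\<^sup>2)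
        + 4 / 3 * ((\<Sum>i\<in>UNIV. v $ i) * (\<Sum>j\<in>UNIV. v $ j))"
      unfolding sum_product by (simp only: sum.distrib sum_distrib_left)
    also have "\<dots> = ?N * ?N * (norm v)\<^sup>2 - 2 / 3 * ?N * (norm v)\<^sup>2"
      unfolding assms(2)
      by (simp add: sum_subtractf sum_divide_distrib[symmetric] sum_distrib_left[symmetric] norm_sq_eq_sum)
        (simp add: algebra_simps)
    finally have a: "(\<Sum>i\<in>UNIV. \<Sum>j\<in>UNIV.
          (norm v)\<^sup>2 - (v $ i)\<^sup>2 - (v $ j)\<^sup>2 + 2 / 3 * (v $ i + v $ j)\<^sup>2)
        = ?N * ?N * (norm v)\<^sup>2 - 2 / 3 * ?N * (norm v)\<^sup>2" .
    have "(\<Sum>i\<in>UNIV. (norm v)\<^sup>2 - (v $ i)\<^sup>2 - (v $ i)\<^sup>2 + 2 / 3 * (v $ i + v $ i)\<^sup>2)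
        = (\<Sum>i\<in>UNIV. (norm v)\<^sup>2 + 2 / 3 * (v $ i)\<^sup>2)"
      by (intro sum.cong refl) (simp add: power2_eq_square field_simps)
    also have "\<dots> = ?N * (norm v)\<^sup>2 + 2 / 3 * (norm v)\<^sup>2"
      by (simp add: sum.distrib sum_distrib_left[symmetric] sum_divide_distrib[symmetric] norm_sq_eq_sum)
    finally show ?thesis
      unfolding sum_index_pairs a by (simp add: algebra_simps)
  qed
  finally have "integral\<^sup>L step_noise ?g
      = (?N * (?N - 1) - 2 / 3 * (?N + 1)) * (norm v)\<^sup>2 / (?N * (?N - 1))"
    unfolding card_index_pairs .
  moreover have "?N \<ge> 2" using assms(1) by simp
  ultimately show ?E
    by (simp add: contraction_rate_def field_simps)
qed

section \<open>Invariance of the uniform distribution\<close>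

lemma emeasure_coag_frag_kernel:
  fixes x :: "real ^ 'n"
  assumes "x \<in> prob_simplex" "A \<in> sets simplex_space"
  shows "emeasure (coag_frag_kernel x) A
    = (\<Sum>(i, j)\<in>index_pairs. ennreal (1 / card (index_pairs :: ('n \<times> 'n) set))
        * (\<integral>\<^sup>+u. indicator A (coag_frag_step i j u x) \<partial>restrict_space lborel {0..1}))"
proof -
  let ?C = "uniform_count_measure (index_pairs :: ('n \<times> 'n) set)"
  interpret U: prob_space "restrict_space lborel {0..1 :: real}" by (rule prob_space_unit_interval)
  note m = measurable_step_noise[OF assms(1)]
  have ind: "(\<lambda>y. indicator A y :: ennreal) \<in> borel_measurable simplex_space"
    using assms(2) by (rule borel_measurable_indicator)
  have "emeasure (coag_frag_kernel x) A = (\<integral>\<^sup>+y. indicator A y \<partial>coag_frag_kernel x)"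
    using assms(2) by (simp add: coag_frag_kernel_def)
  also have "\<dots> = (\<integral>\<^sup>+((i, j), u). indicator A (coag_frag_step i j u x) \<partial>step_noise)"
    unfolding coag_frag_kernel_def using m ind by (subst nn_integral_distr) (auto simp: case_prod_unfold)
  also have "\<dots> = (\<integral>\<^sup>+p. (\<integral>\<^sup>+u. indicator A (coag_frag_step (fst p) (snd p) u x)
      \<partial>restrict_space lborel {0..1}) \<partial>?C)"
    using measurable_compose[OF m ind]
    by (subst U.nn_integral_fst[symmetric]) (auto simp: case_prod_unfold)
  also have "\<dots> = (\<Sum>(i, j)\<in>index_pairs. ennreal (1 / card (index_pairs :: ('n \<times> 'n) set))
        * (\<integral>\<^sup>+u. indicator A (coag_frag_step i j u x) \<partial>restrict_space lborel {0..1}))"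
    unfolding uniform_count_measure_def
    by (subst nn_integral_point_measure_finite) (auto simp: case_prod_unfold)
  finally show ?thesis .
qed

lemma measurable_nn_integral_step:
  fixes g :: "real ^ 'n \<Rightarrow> ennreal"
  assumes [measurable]: "g \<in> borel_measurable borel"
  shows "(\<lambda>x. \<integral>\<^sup>+u. g (coag_frag_step i j u x) \<partial>restrict_space lborel {0..1})
    \<in> borel_measurable borel"
proof -
  interpret U: prob_space "restrict_space lborel {0..1 :: real}" by (rule prob_space_unit_interval)
  have [measurable]: "(\<lambda>u. u) \<in> restrict_space lborel {0..1 :: real} \<rightarrow>\<^sub>M borel"
    by (rule measurable_restrict_space1) simp
  have "(\<lambda>z. (fst z, snd z)) \<in> borel \<Otimes>\<^sub>M restrict_space lborel {0..1 :: real} \<rightarrow>\<^sub>M borel \<Otimes>\<^sub>M borel"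
    by measurable
  from measurable_compose[OF this measurable_compose[OF measurable_step_pair assms]]
  show ?thesis
    by (intro U.borel_measurable_nn_integral) (simp add: case_prod_unfold)
qed

text \<open>Lebesgue measure on an interval is unchanged when each of its points is replaced by a fresh uniform
  one. Negative \<open>s\<close> are included because the lines used below also run outside the simplex, where the
  interval to be resampled may be empty.\<close>

lemma nn_integral_uniform_resampling:
  fixes h :: "real \<Rightarrow> ennreal"
  assumes [measurable]: "h \<in> borel_measurable borel"
  shows "(\<integral>\<^sup>+t. indicator {0..s} t * (\<integral>\<^sup>+u. h (u * s) \<partial>restrict_space lborel {0..1}) \<partial>lborel)
    = (\<integral>\<^sup>+t. indicator {0..s} t * h t \<partial>lborel)"
proof (cases s "0 :: real" rule: linorder_cases)
  case equal
  \<comment> \<open>The interval is a null set, although the resampled point \<open>u * s\<close> always lies in it.\<close>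
  have "AE t in lborel. t \<noteq> (0 :: real)" by (rule AE_lborel_singleton)
  then have ae: "AE t in lborel. indicator {0..s} t * c t = (0 :: ennreal)" for c :: "real \<Rightarrow> ennreal"
    by eventually_elim (auto simp: equal)
  show ?thesis
    by (simp only: nn_integral_cong_AE[OF ae])
next
  case greater
  have "(\<integral>\<^sup>+t. indicator {0..s} t * (\<integral>\<^sup>+u. h (u * s) \<partial>restrict_space lborel {0..1}) \<partial>lborel)
      = ennreal s * (\<integral>\<^sup>+u. h (u * s) \<partial>restrict_space lborel {0..1})"
    using greater by (subst nn_integral_multc) auto
  also have "\<dots> = ennreal s * (\<integral>\<^sup>+u. indicator {0..s} (s * u) * h (s * u) \<partial>lborel)"
    using greater
    by (subst nn_integral_restrict_space)
      (auto intro!: arg_cong2[where f="(*)"] nn_integral_cong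
        simp: mult.commute zero_le_mult_iff split: split_indicator)
  also have "\<dots> = (\<integral>\<^sup>+t. indicator {0..s} t * h t \<partial>lborel)"
    using greater by (subst nn_integral_real_affine[where c=s and t=0]) auto
  finally show ?thesis .
qed simp

text \<open>Integration over the hyperplane one line at a time, each line moving mass between the coordinates
  \<open>i\<close> and \<open>j\<close> and fixing all others. Here \<open>j\<close> is the coordinate that the parametrization
  eliminates.\<close>

lemma nn_integral_hyperplane_split:
  fixes f :: "real ^ 'n \<Rightarrow> ennreal"
  assumes "i \<noteq> j" and [measurable]: "f \<in> borel_measurable borel"
  shows "(\<integral>\<^sup>+x. f x \<partial>hyperplane_lebesgue j)
    = (\<integral>\<^sup>+z. (\<integral>\<^sup>+t. f (hyperplane_point j (z(i := t))) \<partial>lborel) \<partial>PiM (UNIV - {i, j}) (\<lambda>_. lborel))"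
proof -
  interpret product_sigma_finite "\<lambda>_ :: 'n. lborel :: real measure" ..
  have J: "UNIV - {j} = insert i (UNIV - {i, j})" using assms(1) by auto
  have m: "(\<lambda>y. f (hyperplane_point j y)) \<in> borel_measurable (PiM (UNIV - {j}) (\<lambda>_. lborel))"
    by measurable
  have "(\<integral>\<^sup>+x. f x \<partial>hyperplane_lebesgue j)
      = (\<integral>\<^sup>+y. f (hyperplane_point j y) \<partial>PiM (UNIV - {j}) (\<lambda>_. lborel))"
    unfolding hyperplane_lebesgue_def by (subst nn_integral_distr) auto
  also have "\<dots> = (\<integral>\<^sup>+z. (\<integral>\<^sup>+t. f (hyperplane_point j (z(i := t))) \<partial>lborel)
      \<partial>PiM (UNIV - {i, j}) (\<lambda>_. lborel))"
    using m unfolding J by (subst product_nn_integral_insert) auto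
  finally show ?thesis .
qed

text \<open>Already for a fixed pair the step preserves the uniform distribution. Given the other coordinates,
  \<open>x\<^sub>i + x\<^sub>j\<close> is a constant \<open>s\<close>, the simplex cuts the interval \<open>0 \<le> x\<^sub>i \<le> s\<close> out of the line, and the
  step resamples \<open>x\<^sub>i\<close> uniformly from that interval.\<close>

lemma nn_integral_step_hyperplane_lebesgue:
  fixes g :: "real ^ 'n \<Rightarrow> ennreal"
  assumes ij: "i \<noteq> j" and g [measurable]: "g \<in> borel_measurable borel"
  shows "(\<integral>\<^sup>+x. indicator prob_simplex x *
        (\<integral>\<^sup>+u. g (coag_frag_step i j u x) \<partial>restrict_space lborel {0..1}) \<partial>hyperplane_lebesgue k)
    = (\<integral>\<^sup>+x. indicator prob_simplex x * g x \<partial>hyperplane_lebesgue k)"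
proof -
  let ?U = "restrict_space lborel {0..1 :: real}"
  let ?J = "UNIV - {i, j}"
  note [measurable] = measurable_nn_integral_step[OF g, of i j]
  have "(\<integral>\<^sup>+t. indicator prob_simplex (hyperplane_point j (z(i := t))) *
          (\<integral>\<^sup>+u. g (coag_frag_step i j u (hyperplane_point j (z(i := t)))) \<partial>?U) \<partial>lborel)
      = (\<integral>\<^sup>+t. indicator prob_simplex (hyperplane_point j (z(i := t)))
          * g (hyperplane_point j (z(i := t))) \<partial>lborel)"
    if z: "z \<in> space (PiM ?J (\<lambda>_. lborel :: real measure))" for z
  proof -
    define w where "w t = hyperplane_point j (z(i := t))" for t
    define s where "s = 1 - (\<Sum>l\<in>?J. z l)"
    have J: "UNIV - {j} = insert i ?J" using ij by auto
    have "(\<Sum>l\<in>UNIV - {j}. (z(i := t)) l) = t + (\<Sum>l\<in>?J. z l)" for t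
      unfolding J by (simp add: sum.insert_if)
    then have w: "w t $ l = (if l = i then t else if l = j then s - t else z l)" for t l
      using ij by (auto simp: w_def s_def hyperplane_point_def)
    have step: "coag_frag_step i j u (w t) = w (u * s)" for u t
      using ij by (auto simp: vec_eq_iff coag_frag_step_def w algebra_simps)
    have total: "(\<Sum>l\<in>UNIV. w t $ l) = 1" for t
      by (subst sum.remove[of _ j]) (auto simp: w_def hyperplane_point_def)
    \<comment> \<open>\<open>b\<close> is the sign condition on the fixed coordinates; if these sum to more than \<open>1\<close>, then
      \<open>s < 0\<close> and the interval \<open>{0..s}\<close> is empty.\<close>
    define b :: ennreal where "b = (if \<forall>l\<in>?J. 0 \<le> z l then 1 else 0)"
    have mem: "indicator prob_simplex (w t) = b * indicator {0..s} t" for t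
      using ij total[of t] by (auto simp: prob_simplex_def w b_def indicator_def)
    have "(\<lambda>t. z(i := t)) \<in> lborel \<rightarrow>\<^sub>M PiM (UNIV - {j}) (\<lambda>_. lborel)"
      unfolding J using z by (intro measurable_fun_upd[where J="?J"]) auto
    from measurable_compose[OF this hyperplane_point_measurable]
    have [measurable]: "w \<in> borel \<rightarrow>\<^sub>M borel" by (simp add: w_def[abs_def])
    have "(\<integral>\<^sup>+t. indicator prob_simplex (w t) * (\<integral>\<^sup>+u. g (coag_frag_step i j u (w t)) \<partial>?U) \<partial>lborel)
        = b * (\<integral>\<^sup>+t. indicator {0..s} t * (\<integral>\<^sup>+u. g (w (u * s)) \<partial>?U) \<partial>lborel)"
      unfolding mem step mult.assoc by (rule nn_integral_cmult) measurable
    also have "\<dots> = b * (\<integral>\<^sup>+t. indicator {0..s} t * g (w t) \<partial>lborel)"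
      by (subst nn_integral_uniform_resampling) auto
    also have "\<dots> = (\<integral>\<^sup>+t. indicator prob_simplex (w t) * g (w t) \<partial>lborel)"
      unfolding mem mult.assoc by (rule nn_integral_cmult[symmetric]) measurable
    finally show ?thesis unfolding w_def .
  qed
  note fibre = nn_integral_cong[OF this]
  show ?thesis
    unfolding hyperplane_lebesgue_indep[of k j]
    by (subst (1 2) nn_integral_hyperplane_split[OF ij]) (measurable, rule fibre)
qed

lemma nn_integral_simplex_uniform:
  fixes f :: "real ^ 'n \<Rightarrow> ennreal"
  assumes [measurable]: "f \<in> borel_measurable borel"
  shows "(\<integral>\<^sup>+x. f x \<partial>simplex_uniform)
    = (\<integral>\<^sup>+x. indicator prob_simplex x * f x \<partial>hyperplane_lebesgue k)
      / emeasure (hyperplane_lebesgue k) prob_simplex"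
proof -
  let ?H = "hyperplane_lebesgue (SOME k. True) :: (real ^ 'n) measure"
  have sets: "sets ?H = sets borel" by (simp add: hyperplane_lebesgue_def)
  have S: "prob_simplex \<inter> space ?H \<in> sets ?H"
    using prob_simplex_sets by (simp add: sets sets_eq_imp_space_eq[OF sets])
  have "f \<in> borel_measurable ?H" using assms by (simp add: measurable_cong_sets[OF sets refl])
  then have "(\<integral>\<^sup>+x. f x \<partial>simplex_uniform)
      = (\<integral>\<^sup>+x. f x * indicator prob_simplex x \<partial>restrict_space ?H prob_simplex)
        / emeasure (restrict_space ?H prob_simplex) prob_simplex"
    unfolding simplex_uniform_def using S
    by (intro nn_integral_uniform_measure measurable_restrict_space1)
      (auto simp: sets_restrict_space_iff sets)
  also have "\<dots> = (\<integral>\<^sup>+x. indicator prob_simplex x * f x \<partial>?H) / emeasure ?H prob_simplex"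
    using S by (auto simp: nn_integral_restrict_space emeasure_restrict_space
      intro!: arg_cong2[where f="(/)"] nn_integral_cong split: split_indicator)
  finally show ?thesis
    unfolding hyperplane_lebesgue_indep[of "SOME k. True" k] .
qed

theorem simplex_uniform_invariant:
  assumes "CARD('n::finite) \<ge> 2"
  shows "coag_frag_invariant (simplex_uniform :: (real ^ 'n) measure)"
proof -
  let ?\<pi> = "simplex_uniform :: (real ^ 'n) measure"
  let ?U = "restrict_space lborel {0..1 :: real}"
  let ?c = "ennreal (1 / card (index_pairs :: ('n \<times> 'n) set))"
  have \<pi>: "?\<pi> \<in> space (prob_algebra simplex_space)" by (rule simplex_uniform_prob)
  note \<kappa> = coag_frag_kernel_measurable[OF assms]
  have sets: "sets ?\<pi> = sets simplex_space" using \<pi> by (simp add: space_prob_algebra)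
  have "emeasure (?\<pi> \<bind> coag_frag_kernel) A = emeasure ?\<pi> A" if A: "A \<in> sets simplex_space" for A
  proof -
    have [measurable]: "A \<in> sets borel"
      using A by (simp add: sets_restrict_space_iff)
    have g: "(\<lambda>x. indicator A x :: ennreal) \<in> borel_measurable borel" by measurable
    note m = measurable_nn_integral_step[OF g]
    have pair: "(\<integral>\<^sup>+x. (\<integral>\<^sup>+u. indicator A (coag_frag_step i j u x) \<partial>?U) \<partial>?\<pi>) = emeasure ?\<pi> A"
      if "i \<noteq> j" for i j
      using nn_integral_simplex_uniform[OF m[of i j], of undefined]
        nn_integral_simplex_uniform[OF g, of undefined]
        nn_integral_step_hyperplane_lebesgue[OF that g] A sets by simp
    have "emeasure (?\<pi> \<bind> coag_frag_kernel) A = (\<integral>\<^sup>+x. emeasure (coag_frag_kernel x) A \<partial>?\<pi>)"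
      by (rule emeasure_bind_prob_algebra[OF \<pi> \<kappa> A])
    also have "\<dots> = (\<integral>\<^sup>+x. (\<Sum>(i, j)\<in>index_pairs. ?c *
        (\<integral>\<^sup>+u. indicator A (coag_frag_step i j u x) \<partial>?U)) \<partial>?\<pi>)"
      using sets_eq_imp_space_eq[OF sets]
      by (intro nn_integral_cong emeasure_coag_frag_kernel A) (simp add: space_restrict_space)
    also have "\<dots> = (\<Sum>(i, j)\<in>index_pairs. ?c *
        (\<integral>\<^sup>+x. (\<integral>\<^sup>+u. indicator A (coag_frag_step i j u x) \<partial>?U) \<partial>?\<pi>))"
    proof -
      have m': "(\<lambda>x. \<integral>\<^sup>+u. indicator A (coag_frag_step i j u x) \<partial>?U) \<in> borel_measurable ?\<pi>" for i j
        using measurable_restrict_space1[OF m[of i j]] by (simp add: measurable_cong_sets[OF sets refl])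
      show ?thesis
        unfolding case_prod_unfold by (subst nn_integral_sum) (auto simp: nn_integral_cmult[OF m'] intro!: borel_measurable_times_ennreal m')
    qed
    also have "\<dots> = (\<Sum>p\<in>(index_pairs :: ('n \<times> 'n) set). ?c * emeasure ?\<pi> A)"
      by (rule sum.cong) (auto simp: pair)
    also have "\<dots> = emeasure ?\<pi> A"
    proof -
      have "card (index_pairs :: ('n \<times> 'n) set) \<noteq> 0"
        using index_pairs_nonempty[OF assms] by simp
      then have "of_nat (card (index_pairs :: ('n \<times> 'n) set)) * ?c = 1"
        by (simp add: ennreal_of_nat_eq_real_of_nat ennreal_mult[symmetric])
      then show ?thesis by (simp add: mult.assoc[symmetric])
    qed
    finally show ?thesis .
  qed
  then have "?\<pi> \<bind> coag_frag_kernel = ?\<pi>"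
    by (intro measure_eqI) (simp_all add: sets_bind'[OF \<pi> \<kappa>] sets)
  then show ?thesis
    unfolding coag_frag_invariant_def using \<pi> by simp
qed

section \<open>Test functions and the kernel\<close>

lemma norm_prob_simplex_le:
  fixes x :: "real ^ 'n"
  assumes "x \<in> prob_simplex"
  shows "norm x \<le> 1"
  using assms norm_le_l1_cart[of x] by (simp add: prob_simplex_def)

lemma compact_prob_simplex: "compact (prob_simplex :: (real ^ 'n) set)"
  using closed_prob_simplex norm_prob_simplex_le
  by (auto simp: compact_eq_bounded_closed bounded_iff)

lemma norm_diff_prob_simplex:
  fixes x y :: "real ^ 'n"
  assumes "x \<in> prob_simplex" "y \<in> prob_simplex"
  shows "(norm (x - y))\<^sup>2 \<le> 4"
proof -
  have "norm (x - y) \<le> 2"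
    using norm_triangle_ineq4[of x y] assms[THEN norm_prob_simplex_le] by linarith
  then show ?thesis
    using power_mono[of "norm (x - y)" 2 2] by simp
qed

text \<open>A modulus of continuity that is affine in the squared distance. Being affine, it can be averaged over
  the noise term by term, so the contraction in mean square acts directly on the coefficient \<open>K\<close>.
  The absolute value is implicit, since \<open>x\<close> and \<open>y\<close> may be exchanged.\<close>

definition quad_lipschitz :: "real \<Rightarrow> real \<Rightarrow> (real ^ 'n \<Rightarrow> real) \<Rightarrow> bool" where
  "quad_lipschitz \<epsilon> K f \<longleftrightarrow>
     (\<forall>x\<in>prob_simplex. \<forall>y\<in>prob_simplex. f x \<le> f y + (\<epsilon> + K * (norm (x - y))\<^sup>2))"

text \<open>The error \<open>\<epsilon>\<close> covers nearby points by uniform continuity, and the quadratic term covers distant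
  ones because \<open>f\<close> is bounded.\<close>

lemma continuous_on_imp_quad_lipschitz:
  fixes f :: "real ^ 'n \<Rightarrow> real"
  assumes f: "continuous_on prob_simplex f" and "\<epsilon> > 0"
  obtains K where "K \<ge> 0" "quad_lipschitz \<epsilon> K f"
proof -
  obtain B where B: "\<And>x. x \<in> prob_simplex \<Longrightarrow> \<bar>f x\<bar> \<le> B"
    using compact_imp_bounded[OF compact_continuous_image[OF f compact_prob_simplex]]
    by (auto simp: bounded_iff)
  then have "B \<ge> 0"
    using prob_simplex_nonempty by (metis abs_ge_zero all_not_in_conv order_trans)
  obtain d where d: "d > 0"
    "\<And>x y. x \<in> prob_simplex \<Longrightarrow> y \<in> prob_simplex \<Longrightarrow> dist x y < d \<Longrightarrow> dist (f x) (f y) < \<epsilon>"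
    using compact_uniformly_continuous[OF f compact_prob_simplex] \<open>\<epsilon> > 0\<close>
    unfolding uniformly_continuous_on_def by metis
  \<comment> \<open>At distance at least \<open>d\<close> the quadratic term exceeds \<open>2 * B\<close>, the largest possible oscillation.\<close>
  define K where "K = 2 * B / d\<^sup>2"
  have K: "K \<ge> 0" using \<open>B \<ge> 0\<close> by (simp add: K_def)
  have "f x \<le> f y + (\<epsilon> + K * (norm (x - y))\<^sup>2)" if xy: "x \<in> prob_simplex" "y \<in> prob_simplex" for x y
  proof (cases "dist x y < d")
    case True
    then have "f x \<le> f y + \<epsilon>" using d(2)[OF xy] by (simp add: dist_real_def)
    moreover have "0 \<le> K * (norm (x - y))\<^sup>2" using K by simp
    ultimately show ?thesis by linarith
  next
    case False
    then have "d\<^sup>2 \<le> (norm (x - y))\<^sup>2"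
      using \<open>d > 0\<close> by (intro power_mono) (auto simp: dist_norm)
    then have "K * d\<^sup>2 \<le> K * (norm (x - y))\<^sup>2" using K by (rule mult_left_mono)
    moreover have "K * d\<^sup>2 = 2 * B" using \<open>d > 0\<close> by (simp add: K_def)
    ultimately show ?thesis using B[OF xy(1)] B[OF xy(2)] \<open>\<epsilon> > 0\<close> by linarith
  qed
  then show thesis using that K by (auto simp: quad_lipschitz_def)
qed

text \<open>Both kernel integrals are written over the same noise, which is the synchronous coupling; then the
  modulus of \<open>f\<close> is averaged. The error \<open>\<epsilon>\<close> does not grow, so the estimate can be iterated.\<close>

lemma quad_lipschitz_kernel:
  fixes f :: "real ^ 'n \<Rightarrow> real"
  assumes N: "CARD('n) \<ge> 2" and f: "f \<in> borel_measurable simplex_space"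
    and B: "\<And>x. x \<in> prob_simplex \<Longrightarrow> \<bar>f x\<bar> \<le> B"
    and q: "quad_lipschitz \<epsilon> K f"
  shows "quad_lipschitz \<epsilon> (K * contraction_rate CARD('n)) (\<lambda>x. integral\<^sup>L (coag_frag_kernel x) f)"
  unfolding quad_lipschitz_def
proof (intro ballI)
  fix x y :: "real ^ 'n" assume xy: "x \<in> prob_simplex" "y \<in> prob_simplex"
  interpret P: pair_prob_space "uniform_count_measure (index_pairs :: ('n \<times> 'n) set)"
      "restrict_space lborel {0..1 :: real}"
    by (rule pair_prob_space_noise[OF N])
  let ?s = "\<lambda>x :: real ^ 'n. \<lambda>((i, j), u). coag_frag_step i j u x"
  have mem: "?s z \<omega> \<in> prob_simplex" if "z \<in> prob_simplex" "\<omega> \<in> space step_noise" for z \<omega>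
    using measurable_space[OF measurable_step_noise[OF that(1)] that(2)]
    by (simp add: space_restrict_space)
  have eq: "integral\<^sup>L (coag_frag_kernel z) f = (\<integral>\<omega>. f (?s z \<omega>) \<partial>step_noise)" if "z \<in> prob_simplex" for z
    unfolding coag_frag_kernel_def by (rule integral_distr[OF measurable_step_noise[OF that] f])
  have int: "integrable step_noise (\<lambda>\<omega>. f (?s z \<omega>))" if "z \<in> prob_simplex" for z
  proof (rule P.P.integrable_const_bound[where B=B])
    show "AE \<omega> in step_noise. norm (f (?s z \<omega>)) \<le> B"
      using B mem[OF that] by (intro AE_I2) (simp only: real_norm_def)
    show "(\<lambda>\<omega>. f (?s z \<omega>)) \<in> borel_measurable step_noise"
      by (rule measurable_compose[OF measurable_step_noise[OF that] f])
  qed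
  have diff: "?s x \<omega> - ?s y \<omega> = ?s (x - y) \<omega>" for \<omega>
    by (auto simp: vec_eq_iff coag_frag_step_def algebra_simps split: prod.split)
  have zero: "(\<Sum>l\<in>UNIV. (x - y) $ l) = 0"
    using xy by (simp add: prob_simplex_def sum_subtractf)
  have sq: "(\<lambda>\<omega>. (norm (?s (x - y) \<omega>))\<^sup>2) = (\<lambda>((i, j), u). (norm (coag_frag_step i j u (x - y)))\<^sup>2)"
    by (auto simp: fun_eq_iff)
  note intsq = integrable_norm_step_sq[OF N zero, folded sq]
  have "integral\<^sup>L (coag_frag_kernel x) f
      \<le> (\<integral>\<omega>. f (?s y \<omega>) + (\<epsilon> + K * (norm (?s (x - y) \<omega>))\<^sup>2) \<partial>step_noise)"
    unfolding eq[OF xy(1)]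
  proof (rule integral_mono)
    fix \<omega> :: "('n \<times> 'n) \<times> real" assume w: "\<omega> \<in> space step_noise"
    show "f (?s x \<omega>) \<le> f (?s y \<omega>) + (\<epsilon> + K * (norm (?s (x - y) \<omega>))\<^sup>2)"
      unfolding diff[symmetric] using q mem[OF xy(1) w] mem[OF xy(2) w]
      unfolding quad_lipschitz_def by blast
  qed (intro Bochner_Integration.integrable_add int xy integrable_mult_right intsq P.P.integrable_const)+
  also have "\<dots> = (\<integral>\<omega>. f (?s y \<omega>) \<partial>step_noise)
      + (\<epsilon> + K * (\<integral>\<omega>. (norm (?s (x - y) \<omega>))\<^sup>2 \<partial>step_noise))"
    using int[OF xy(2)] intsq by (simp add: P.P.prob_space)
  also have "\<dots> = integral\<^sup>L (coag_frag_kernel y) f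
      + (\<epsilon> + K * contraction_rate CARD('n) * (norm (x - y))\<^sup>2)"
    unfolding sq integral_norm_step_sq[OF N zero] eq[OF xy(2)] by simp
  finally show "integral\<^sup>L (coag_frag_kernel x) f \<le> integral\<^sup>L (coag_frag_kernel y) f
      + (\<epsilon> + K * contraction_rate CARD('n) * (norm (x - y))\<^sup>2)" .
qed

text \<open>Averages of \<open>f\<close> differ by at most its oscillation, whatever the two distributions. This is the estimate
  before any step has been taken.\<close>

lemma integral_diff_le_quad_lipschitz:
  fixes f :: "real ^ 'n \<Rightarrow> real"
  assumes \<mu>: "\<mu> \<in> space (prob_algebra simplex_space)" and \<nu>: "\<nu> \<in> space (prob_algebra simplex_space)"
    and f: "f \<in> borel_measurable simplex_space"
    and B: "\<And>x. x \<in> prob_simplex \<Longrightarrow> \<bar>f x\<bar> \<le> B"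
    and q: "quad_lipschitz \<epsilon> K f" and K: "K \<ge> 0"
  shows "integral\<^sup>L \<mu> f \<le> integral\<^sup>L \<nu> f + (\<epsilon> + K * 4)"
proof -
  have *: "prob_space \<rho> \<and> space \<rho> = prob_simplex \<and> integrable \<rho> f"
    if "\<rho> \<in> space (prob_algebra simplex_space)" for \<rho>
  proof -
    have s: "sets \<rho> = sets simplex_space" and p: "prob_space \<rho>"
      using that by (auto simp: space_prob_algebra)
    have sp: "space \<rho> = prob_simplex"
      using sets_eq_imp_space_eq[OF s] by (simp add: space_restrict_space)
    interpret prob_space \<rho> by fact
    have "integrable \<rho> f"
      by (rule integrable_const_bound[where B=B])
        (use f B in \<open>auto simp: sp measurable_cong_sets[OF s refl]\<close>)
    then show ?thesis using p sp by simp
  qed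
  interpret M: prob_space \<mu> using *[OF \<mu>] by simp
  interpret V: prob_space \<nu> using *[OF \<nu>] by simp
  have le: "f x \<le> f y + (\<epsilon> + K * 4)" if "x \<in> prob_simplex" "y \<in> prob_simplex" for x y
  proof -
    have "f x \<le> f y + (\<epsilon> + K * (norm (x - y))\<^sup>2)" using q that by (simp add: quad_lipschitz_def)
    moreover have "K * (norm (x - y))\<^sup>2 \<le> K * 4"
      using norm_diff_prob_simplex[OF that] K by (rule mult_left_mono)
    ultimately show ?thesis by linarith
  qed
  have "integral\<^sup>L \<mu> f \<le> f y + (\<epsilon> + K * 4)" if "y \<in> prob_simplex" for y
  proof -
    have "integral\<^sup>L \<mu> f \<le> (\<integral>x. f y + (\<epsilon> + K * 4) \<partial>\<mu>)"
      by (rule integral_mono) (use *[OF \<mu>] le that in auto)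
    then show ?thesis by (simp add: M.prob_space)
  qed
  then have "(\<integral>y. integral\<^sup>L \<mu> f - (\<epsilon> + K * 4) \<partial>\<nu>) \<le> integral\<^sup>L \<nu> f"
    using *[OF \<nu>] by (intro integral_mono) (auto simp: algebra_simps)
  then show ?thesis by (simp add: V.prob_space)
qed

lemma integral_bind_kernel:
  fixes f :: "real ^ 'n \<Rightarrow> real"
  assumes N: "CARD('n) \<ge> 2" and \<mu>: "\<mu> \<in> space (prob_algebra simplex_space)"
    and f: "f \<in> borel_measurable simplex_space"
    and B: "\<And>x. x \<in> prob_simplex \<Longrightarrow> \<bar>f x\<bar> \<le> B"
  shows "integral\<^sup>L (\<mu> \<bind> coag_frag_kernel) f = (\<integral>x. integral\<^sup>L (coag_frag_kernel x) f \<partial>\<mu>)"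
proof -
  note \<kappa> = coag_frag_kernel_measurable[OF N]
  have s: "sets \<mu> = sets simplex_space" and p: "prob_space \<mu>"
    using \<mu> by (auto simp: space_prob_algebra)
  interpret prob_space \<mu> by fact
  have m: "coag_frag_kernel \<in> \<mu> \<rightarrow>\<^sub>M subprob_algebra simplex_space"
    using measurable_prob_algebraD[OF \<kappa>] by (simp add: measurable_cong_sets[OF s refl])
  have "AE x in \<mu>. emeasure (coag_frag_kernel x) (space (coag_frag_kernel x)) \<le> ennreal 1"
    using measurable_space[OF \<kappa>] sets_eq_imp_space_eq[OF s]
    by (intro AE_I2) (auto simp: space_prob_algebra prob_space.emeasure_space_1)
  then show ?thesis
    by (intro integral_bind[OF f _ m, where B=B and B'=1])
      (auto simp: B finite_measure_axioms space_restrict_space)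
qed

lemma integral_kernel_measurable_bounded:
  fixes f :: "real ^ 'n \<Rightarrow> real"
  assumes N: "CARD('n) \<ge> 2" and f: "f \<in> borel_measurable simplex_space"
    and B: "\<And>x. x \<in> prob_simplex \<Longrightarrow> \<bar>f x\<bar> \<le> B"
  shows "(\<lambda>x. integral\<^sup>L (coag_frag_kernel x) f) \<in> borel_measurable simplex_space"
    and "x \<in> prob_simplex \<Longrightarrow> \<bar>integral\<^sup>L (coag_frag_kernel x) f\<bar> \<le> B"
proof -
  note \<kappa> = coag_frag_kernel_measurable[OF N]
  show "(\<lambda>x. integral\<^sup>L (coag_frag_kernel x) f) \<in> borel_measurable simplex_space"
    by (rule measurable_compose[OF measurable_prob_algebraD[OF \<kappa>]
          integral_measurable_subprob_algebra[OF f]])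
  show "\<bar>integral\<^sup>L (coag_frag_kernel x) f\<bar> \<le> B" if x: "x \<in> prob_simplex"
  proof -
    have s: "sets (coag_frag_kernel x) = sets simplex_space" and p: "prob_space (coag_frag_kernel x)"
      using measurable_space[OF \<kappa>, of x] x by (auto simp: space_prob_algebra space_restrict_space)
    interpret prob_space "coag_frag_kernel x" by fact
    have sp: "space (coag_frag_kernel x) = prob_simplex"
      using sets_eq_imp_space_eq[OF s] by (simp add: space_restrict_space)
    have "AE y in coag_frag_kernel x. \<bar>f y\<bar> \<le> B" by (intro AE_I2) (simp add: sp B)
    moreover have int: "integrable (coag_frag_kernel x) f"
      by (rule integrable_const_bound[where B=B])
        (use f B in \<open>auto simp: sp measurable_cong_sets[OF s refl]\<close>)
    ultimately have "integral\<^sup>L (coag_frag_kernel x) f \<le> B" "- B \<le> integral\<^sup>L (coag_frag_kernel x) f"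
      by (auto intro!: integral_le_const integral_ge_const elim!: eventually_mono)
    then show ?thesis by linarith
  qed
qed

section \<open>Convergence\<close>

text \<open>Two evolutions forget their initial distributions. The induction peels off the last step and
  moves it from the measure to the test function, which is why \<open>f\<close> and \<open>K\<close> vary in it. The
  factor \<open>4\<close> bounds the squared distance of two points of the simplex.\<close>

lemma evolution_merging:
  fixes f :: "real ^ 'n \<Rightarrow> real" and \<mu> \<nu> :: "nat \<Rightarrow> (real ^ 'n) measure"
  assumes N: "CARD('n) \<ge> 2"
    and \<mu>: "\<And>t. \<mu> t \<in> space (prob_algebra simplex_space)" "\<And>t. \<mu> (Suc t) = \<mu> t \<bind> coag_frag_kernel"
    and \<nu>: "\<And>t. \<nu> t \<in> space (prob_algebra simplex_space)" "\<And>t. \<nu> (Suc t) = \<nu> t \<bind> coag_frag_kernel"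
    and f: "f \<in> borel_measurable simplex_space"
    and B: "\<And>x. x \<in> prob_simplex \<Longrightarrow> \<bar>f x\<bar> \<le> B"
    and q: "quad_lipschitz \<epsilon> K f" and K: "K \<ge> 0"
  shows "integral\<^sup>L (\<mu> t) f \<le> integral\<^sup>L (\<nu> t) f + (\<epsilon> + K * contraction_rate CARD('n) ^ t * 4)"
  using f B q K
proof (induction t arbitrary: f K)
  case 0
  show ?case using integral_diff_le_quad_lipschitz[OF \<mu>(1) \<nu>(1) 0] by simp
next
  case (Suc t)
  note ib = integral_bind_kernel[OF N _ Suc.prems(1,2)]
  have "K * contraction_rate CARD('n) \<ge> 0"
    using Suc.prems(4) contraction_rate_bounds(1)[OF N] by simp
  from Suc.IH[OF integral_kernel_measurable_bounded[OF N Suc.prems(1,2)]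
      quad_lipschitz_kernel[OF N Suc.prems(1-3)] this]
  show ?case
    unfolding \<mu>(2) \<nu>(2) using ib[OF \<mu>(1)] ib[OF \<nu>(1)] by (simp add: mult.assoc)
qed

text \<open>An invariant distribution is a constant evolution, so merging with it is convergence to it.\<close>

lemma evolution_tendsto_invariant:
  fixes f :: "real ^ 'n \<Rightarrow> real" and \<mu> :: "nat \<Rightarrow> (real ^ 'n) measure"
  assumes N: "CARD('n) \<ge> 2"
    and \<mu>: "\<And>t. \<mu> t \<in> space (prob_algebra simplex_space)" "\<And>t. \<mu> (Suc t) = \<mu> t \<bind> coag_frag_kernel"
    and \<pi>: "coag_frag_invariant \<pi>"
    and f: "continuous_on prob_simplex f"
  shows "(\<lambda>t. integral\<^sup>L (\<mu> t) f) \<longlonglongrightarrow> integral\<^sup>L \<pi> f"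
proof (rule LIMSEQ_I)
  fix r :: real assume "r > 0"
  let ?c = "contraction_rate CARD('n)"
  have \<pi>': "\<pi> \<in> space (prob_algebra simplex_space)" "\<pi> = \<pi> \<bind> coag_frag_kernel"
    using \<pi> by (auto simp: coag_frag_invariant_def)
  have fm: "f \<in> borel_measurable simplex_space"
    using f by (rule borel_measurable_continuous_on_restrict)
  obtain B where B: "\<And>x. x \<in> prob_simplex \<Longrightarrow> \<bar>f x\<bar> \<le> B"
    using compact_imp_bounded[OF compact_continuous_image[OF f compact_prob_simplex]]
    by (auto simp: bounded_iff)
  obtain K where K: "K \<ge> 0" "quad_lipschitz (r / 2) K f"
    using continuous_on_imp_quad_lipschitz[OF f, of "r / 2"] \<open>r > 0\<close> by auto
  have "(\<lambda>t. K * ?c ^ t * 4) \<longlonglongrightarrow> K * 0 * 4"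
    using contraction_rate_bounds[OF N] by (intro tendsto_intros LIMSEQ_power_zero) simp
  from LIMSEQ_D[OF this, of "r / 2"] obtain T where T: "\<And>t. t \<ge> T \<Longrightarrow> \<bar>K * ?c ^ t * 4\<bar> < r / 2"
    using \<open>r > 0\<close> by auto
  have "norm (integral\<^sup>L (\<mu> t) f - integral\<^sup>L \<pi> f) < r" if "t \<ge> T" for t
    using evolution_merging[where \<mu>=\<mu> and \<nu>="\<lambda>_. \<pi>", OF N \<mu> \<pi>' fm B K(2,1), of t]
      evolution_merging[where \<mu>="\<lambda>_. \<pi>" and \<nu>=\<mu>, OF N \<pi>' \<mu> fm B K(2,1), of t] T[OF that]
    unfolding real_norm_def by linarith
  then show "\<exists>T. \<forall>t\<ge>T. norm (integral\<^sup>L (\<mu> t) f - integral\<^sup>L \<pi> f) < r" by blast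
qed

text \<open>Closed sets generate the \<open>\<sigma>\<close>-algebra and are stable under intersection, and the indicator of a closed
  set is the limit of continuous functions that decay linearly in the distance to it.\<close>

lemma simplex_measure_eqI:
  fixes \<mu> \<nu> :: "(real ^ 'n) measure"
  assumes \<mu>: "\<mu> \<in> space (prob_algebra simplex_space)" and \<nu>: "\<nu> \<in> space (prob_algebra simplex_space)"
    and eq: "\<And>f. continuous_on prob_simplex f \<Longrightarrow> integral\<^sup>L \<mu> f = (integral\<^sup>L \<nu> f :: real)"
  shows "\<mu> = \<nu>"
proof -
  let ?E = "{C :: (real ^ 'n) set. closed C \<and> C \<subseteq> prob_simplex}"
  have S: "\<rho> \<in> space (prob_algebra simplex_space) \<Longrightarrow> sets \<rho> = sets simplex_space \<and> prob_space \<rho>" for \<rho>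
    by (simp add: space_prob_algebra)
  have gen: "sets simplex_space = sigma_sets prob_simplex ?E"
  proof -
    have "sets simplex_space = sigma_sets prob_simplex ((\<inter>) prob_simplex ` Collect closed)"
      unfolding borel_eq_closed
      using sigma_sets_Int[OF sigma_sets.Basic[OF CollectI[where P=closed, OF closed_prob_simplex]] subset_UNIV]
      by (simp add: sets_restrict_space sigma_sets.Basic)
    also have "(\<inter>) prob_simplex ` Collect closed = ?E"
      using closed_prob_simplex by (auto intro!: image_eqI[OF _ CollectI])
    finally show ?thesis .
  qed
  have approx: "(\<lambda>n. \<integral>x. max 0 (1 - real n * infdist x C) \<partial>\<rho>) \<longlonglongrightarrow> measure \<rho> C"
    if \<rho>: "\<rho> \<in> space (prob_algebra simplex_space)" and C: "C \<in> ?E" "C \<noteq> {}" for \<rho> C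
  proof -
    have s: "sets \<rho> = sets simplex_space" and p: "prob_space \<rho>" using S[OF \<rho>] by auto
    interpret prob_space \<rho> by fact
    have Cs: "C \<in> sets \<rho>" unfolding s gen using C by auto
    have m: "(\<lambda>x. max 0 (1 - real n * infdist x C)) \<in> borel_measurable \<rho>" for n
      unfolding measurable_cong_sets[OF s refl]
      by (intro borel_measurable_continuous_on_restrict continuous_intros)
    have "(\<lambda>n. \<integral>x. max 0 (1 - real n * infdist x C) \<partial>\<rho>) \<longlonglongrightarrow> (\<integral>x. indicator C x \<partial>\<rho>)"
    proof (rule integral_dominated_convergence[where w="\<lambda>_. 1"])
      show "AE x in \<rho>. (\<lambda>n. max 0 (1 - real n * infdist x C)) \<longlonglongrightarrow> indicator C x"
      proof (rule AE_I2)
        fix x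
        show "(\<lambda>n. max 0 (1 - real n * infdist x C)) \<longlonglongrightarrow> indicator C x"
        proof (cases "x \<in> C")
          case False
          then have pos: "infdist x C > 0" using C by (intro infdist_pos_not_in_closed) auto
          obtain n0 :: nat where n0: "1 / infdist x C \<le> real n0" using real_arch_simple by blast
          have "max 0 (1 - real n * infdist x C) = 0" if "n \<ge> n0" for n
          proof -
            have "1 / infdist x C \<le> real n" using n0 that by linarith
            then show ?thesis using pos by (simp add: divide_le_eq)
          qed
          then have "eventually (\<lambda>n. max 0 (1 - real n * infdist x C) = 0) sequentially"
            by (auto simp: eventually_sequentially)
          then show ?thesis using False by (simp add: tendsto_eventually)
        qed simp
      qed
    qed (use m Cs in \<open>auto simp: infdist_nonneg\<close>)
    then show ?thesis using Cs by simp
  qed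
  show ?thesis
  proof (rule measure_eqI_generator_eq[where E="?E" and \<Omega>=prob_simplex and A="\<lambda>_. prob_simplex"])
    show "Int_stable ?E" by (auto simp: Int_stable_def)
    fix C assume C: "C \<in> ?E"
    interpret M: prob_space \<mu> using S[OF \<mu>] by simp
    interpret V: prob_space \<nu> using S[OF \<nu>] by simp
    show "emeasure \<mu> C = emeasure \<nu> C"
    proof (cases "C = {}")
      case False
      have "(\<integral>x. max 0 (1 - real n * infdist x C) \<partial>\<mu>) = (\<integral>x. max 0 (1 - real n * infdist x C) \<partial>\<nu>)" for n
        by (intro eq continuous_intros)
      with approx[OF \<mu> C False] approx[OF \<nu> C False] have "measure \<mu> C = measure \<nu> C"
        using LIMSEQ_unique by auto
      then show ?thesis by (simp add: M.emeasure_eq_measure V.emeasure_eq_measure)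
    qed simp
  next
    show "emeasure \<mu> prob_simplex \<noteq> \<infinity>"
      using S[OF \<mu>] by (simp add: prob_space_def finite_measure.emeasure_finite)
  qed (use gen S[OF \<mu>] S[OF \<nu>] closed_prob_simplex in auto)
qed

section \<open>From the Markov chain to the evolution of its distributions\<close>

lemma chain_distr_prob:
  assumes "coag_frag_chain M X \<mu>\<^sub>0"
  shows "distr M simplex_space (X t) \<in> space (prob_algebra simplex_space)"
  using assms by (auto simp: coag_frag_chain_def space_prob_algebra intro!: prob_space.prob_space_distr)

text \<open>Taking expectations removes the conditioning on the past, and what remains is the mixture of the
  kernel over the current distribution.\<close>

lemma chain_distr_Suc:
  fixes X :: "nat \<Rightarrow> 'w \<Rightarrow> real ^ 'n"
  assumes N: "CARD('n) \<ge> 2" and ch: "coag_frag_chain M X \<mu>\<^sub>0"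
  shows "distr M simplex_space (X (Suc t)) = distr M simplex_space (X t) \<bind> coag_frag_kernel"
proof -
  note \<kappa> = coag_frag_kernel_measurable[OF N]
  note \<mu> = chain_distr_prob[OF ch]
  have X: "\<And>t. X t \<in> M \<rightarrow>\<^sub>M simplex_space" and M: "prob_space M"
    using ch by (auto simp: coag_frag_chain_def)
  interpret prob_space M by fact
  interpret F: finite_measure_subalgebra M "past M simplex_space X t"
    by unfold_locales (rule subalgebra_past[OF X])
  let ?\<mu> = "\<lambda>t. distr M simplex_space (X t)"
  interpret D: prob_space "?\<mu> t" using \<mu>[of t] by (simp add: space_prob_algebra)
  interpret DS: prob_space "?\<mu> (Suc t)" using \<mu>[of "Suc t"] by (simp add: space_prob_algebra)
  interpret DB: prob_space "?\<mu> t \<bind> coag_frag_kernel" using \<mu> \<kappa> by (rule prob_space_bind')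
  show ?thesis
  proof (rule measure_eqI)
    show "sets (?\<mu> (Suc t)) = sets (?\<mu> t \<bind> coag_frag_kernel)"
      using sets_bind'[OF \<mu> \<kappa>] by simp
    fix A assume "A \<in> sets (?\<mu> (Suc t))"
    then have A: "A \<in> sets simplex_space" by simp
    have ce: "AE \<omega> in M. real_cond_exp M (past M simplex_space X t)
        (\<lambda>\<omega>. indicator A (X (Suc t) \<omega>)) \<omega> = measure (coag_frag_kernel (X t \<omega>)) A"
      using ch A by (simp add: coag_frag_chain_def)
    have im: "(\<lambda>\<omega>. indicator A (X (Suc t) \<omega>) :: real) \<in> borel_measurable M"
      by (rule measurable_compose[OF X borel_measurable_indicator[OF A]])
    have int: "integrable M (\<lambda>\<omega>. indicator A (X (Suc t) \<omega>) :: real)"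
      by (rule integrable_const_bound[where B=1]) (auto simp: im split: split_indicator)
    have km: "(\<lambda>x. measure (coag_frag_kernel x) A) \<in> borel_measurable simplex_space"
      by (rule measurable_compose[OF measurable_prob_algebraD[OF \<kappa>]
          measurable_measure_subprob_algebra[OF A]])
    have "measure (?\<mu> (Suc t)) A = (\<integral>x. indicator A x \<partial>?\<mu> (Suc t))"
      using A sets.sets_into_space[OF A] by (simp add: space_restrict_space Int_absorb2)
    also have "\<dots> = (\<integral>\<omega>. indicator A (X (Suc t) \<omega>) \<partial>M)"
      by (rule integral_distr[OF X borel_measurable_indicator[OF A]])
    also have "\<dots> = (\<integral>\<omega>. real_cond_exp M (past M simplex_space X t)
        (\<lambda>\<omega>. indicator A (X (Suc t) \<omega>)) \<omega> \<partial>M)"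
      using F.real_cond_exp_int(2)[OF int] by simp
    also have "\<dots> = (\<integral>\<omega>. measure (coag_frag_kernel (X t \<omega>)) A \<partial>M)"
      using ce by (intro integral_cong_AE) (auto intro: measurable_compose[OF X km])
    also have "\<dots> = (\<integral>x. measure (coag_frag_kernel x) A \<partial>?\<mu> t)"
      by (rule integral_distr[OF X km, symmetric])
    also have "\<dots> = measure (?\<mu> t \<bind> coag_frag_kernel) A"
      using measurable_prob_algebraD[OF \<kappa>] A by (intro D.measure_bind[symmetric]) auto
    finally show "emeasure (?\<mu> (Suc t)) A = emeasure (?\<mu> t \<bind> coag_frag_kernel) A"
      by (simp add: DS.emeasure_eq_measure DB.emeasure_eq_measure)
  qed
qed

section \<open>Ergodicity\<close>

theorem theorem1:
  assumes "CARD('n::finite) \<ge> 2"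
  shows "coag_frag_invariant (simplex_uniform :: (real ^ 'n) measure) \<and>
    (\<forall>\<nu> :: (real ^ 'n) measure. coag_frag_invariant \<nu> \<longrightarrow> \<nu> = simplex_uniform) \<and>
    (\<forall>(M :: 'w measure) (X :: nat \<Rightarrow> 'w \<Rightarrow> real ^ 'n) \<mu>\<^sub>0. coag_frag_chain M X \<mu>\<^sub>0 \<longrightarrow>
       weakly_converges_on prob_simplex (\<lambda>t. distr M simplex_space (X t)) simplex_uniform)"
proof (intro conjI allI impI)
  show inv: "coag_frag_invariant (simplex_uniform :: (real ^ 'n) measure)"
    using assms by (rule simplex_uniform_invariant)
  show "\<nu> = simplex_uniform" if "coag_frag_invariant \<nu>" for \<nu> :: "(real ^ 'n) measure"
  proof (rule simplex_measure_eqI)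
    show \<nu>: "\<nu> \<in> space (prob_algebra simplex_space)"
      using that by (simp add: coag_frag_invariant_def)
    show "simplex_uniform \<in> space (prob_algebra simplex_space)"
      by (rule simplex_uniform_prob)
    fix f :: "real ^ 'n \<Rightarrow> real" assume "continuous_on prob_simplex f"
    then have "(\<lambda>t::nat. integral\<^sup>L \<nu> f) \<longlonglongrightarrow> integral\<^sup>L simplex_uniform f"
      using that \<nu> inv
      by (intro evolution_tendsto_invariant[OF assms]) (auto simp: coag_frag_invariant_def)
    then show "integral\<^sup>L \<nu> f = integral\<^sup>L simplex_uniform f"
      by (simp add: LIMSEQ_const_iff)
  qed
  show "weakly_converges_on prob_simplex (\<lambda>t. distr M simplex_space (X t)) simplex_uniform"
    if "coag_frag_chain M X \<mu>\<^sub>0" for M :: "'w measure" and X :: "nat \<Rightarrow> 'w \<Rightarrow> real ^ 'n" and \<mu>\<^sub>0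
    unfolding weakly_converges_on_def
    using evolution_tendsto_invariant[where \<mu>="\<lambda>t. distr M simplex_space (X t)",
        OF assms chain_distr_prob[OF that] chain_distr_Suc[OF assms that] inv]
    by blast
qed

end
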